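(* Let $\Omega\subset\mathbb R^d$ be a regular set with $\mu_d(\Omega)>0$ and let $f:\Omega\to\mathbb R$ be continuous a.e. on $\Omega$. Let $[\boldsymbol a,\boldsymbol b]$ be any $d$-dimensional rectangle containing $\Omega$ and let $\mathcal G_{\boldsymbol n}=\{\boldsymbol x_{\boldsymbol i,\boldsymbol n}\}_{\boldsymbol i=\mathbf 1,\ldots,\boldsymbol n}$ ($\boldsymbol n\in\mathbb N^d$) be any asymptotically uniform grid in $[\boldsymbol a,\boldsymbol b]$. For each $\boldsymbol n\in\mathbb N^d$, consider the samples $f(\boldsymbol x_{\boldsymbol i,\boldsymbol n})$ for $\boldsymbol i\in\mathcal I_{\boldsymbol n}(\Omega)=\{\boldsymbol i\in\{\mathbf 1,\ldots,\boldsymbol n\}:\boldsymbol x_{\boldsymbol i,\boldsymbol n}\in\Omega\}$, sort them (with multiplicity) in non-decreasing order, and put them into a vector $(s_0,\ldots,s_{\omega(\boldsymbol n)})$, where $\omega(\boldsymbol n)=\#\mathcal I_{\boldsymbol n}(\Omega)-1$. Let $f^\dag_{\boldsymbol n}:[0,1]\to\mathbb R$ be the linear spline function that interpolates the samples $(s_0,\ldots,s_{\omega(\boldsymbol n)})$ over the equally spaced nodes $(0,\frac1{\omega(\boldsymbol n)},\frac2{\omega(\boldsymbol n)},\ldots,1)$ in $[0,1]$. Then \[ \lim_{\boldsymbol n\to\infty} f^\dag_{\boldsymbol n}(y)=f^\dag(y) \] for every continuity point $y\in(0,1)$ of $f^\dag$. In particular, $f^\dag_{\boldsymbol n}\to f^\dag$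 a.e. in $(0,1)$.
   Context: $\mu_d$ is Lebesgue measure in $\mathbb R^d$; all measure-theoretic terms refer to it. $\mathbb N=\{1,2,\ldots\}$. Regular set: $\Omega\subset\mathbb R^d$ is regular if it is bounded and $\mu_d(\partial\Omega)=0$. Monotone rearrangement: for $f:\Omega\to\mathbb R$ measurable with $0<\mu_d(\Omega)<\infty$, $f^\dag:(0,1)\to\mathbb R$ is $f^\dag(y)=\inf\{u\in\mathbb R:\mu_d\{\boldsymbol x\in\Omega:f(\boldsymbol x)\le u\}/\mu_d(\Omega)\ge y\}$. Multi-indices: inequalities and operations (product, quotient) between vectors are componentwise; $\mathbf 1=(1,\ldots,1)$; $\{\mathbf 1,\ldots,\boldsymbol n\}=\{\boldsymbol i\in\mathbb Z^d:\mathbf 1\le\boldsymbol i\le\boldsymbol n\}$; $\boldsymbol n\to\infty$ means $\min_j n_j\to\infty$. Rectangles: for $\boldsymbol a\le\boldsymbol b$ in $\mathbb R^d$, $[\boldsymbol a,\boldsymbol b]=[a_1,b_1]\times\cdots\times[a_d,b_d]$. Asymptotically uniform grid: a family, indexed by $\boldsymbol n\in\mathbb N^d$, of grids $\mathcal G_{\boldsymbol n}=\{\boldsymbol x_{\boldsymbol i,\boldsymbol n}\}_{\boldsymbol i=\mathbf 1,\ldots,\boldsymbol n}$ of points in $\mathbb R^d$ is asymptotically uniform in $[\boldsymbol a,\boldsymbol b]$ if \[ \lim_{\boldsymbol n\to\infty}\max_{\boldsymbol i=\mathbf 1,\ldots,\boldsymbol n}\Bigl\|\boldsymbol x_{\boldsymbol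 i,\boldsymbol n}-\Bigl(\boldsymbol a+\boldsymbol i\,\frac{\boldsymbol b-\boldsymbol a}{\boldsymbol n}\Bigr)\Bigr\|_\infty=0. \] Linear spline: $f^\dag_{\boldsymbol n}(i/\omega(\boldsymbol n))=s_i$ for $i=0,\ldots,\omega(\boldsymbol n)$ and $f^\dag_{\boldsymbol n}$ is affine on each $[\frac i{\omega(\boldsymbol n)},\frac{i+1}{\omega(\boldsymbol n)}]$. It is defined when $\omega(\boldsymbol n)\ge1$, which holds whenever $\min_j n_j$ is sufficiently large; $f^\dag_{\boldsymbol n}$ may be taken arbitrary for the other $\boldsymbol n$. *)

theory Defs
  imports "HOL-Analysis.Analysis" "HOL-Library.Multiset"
begin

definition regular_set :: "(real ^ 'd) set \<Rightarrow> bool" where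
  "regular_set \<Omega> \<longleftrightarrow> bounded \<Omega> \<and> emeasure lebesgue (frontier \<Omega>) = 0"

text \<open>The function \<open>f\<close> lives on \<open>\<Omega>\<close>, so continuity at a point of \<open>\<Omega>\<close> is relative to \<open>\<Omega>\<close>.\<close>

definition continuous_ae_on :: "(real ^ 'd) set \<Rightarrow> (real ^ 'd \<Rightarrow> real) \<Rightarrow> bool" where
  "continuous_ae_on \<Omega> f \<longleftrightarrow> (AE x in lebesgue. x \<in> \<Omega> \<longrightarrow> continuous (at x within \<Omega>) f)"

text \<open>Only the values for \<open>0 < y < 1\<close> are meaningful.\<close>

definition monotone_rearrangement ::
    "(real ^ 'd) set \<Rightarrow> (real ^ 'd \<Rightarrow> real) \<Rightarrow> real \<Rightarrow> real" where
  "monotone_rearrangement \<Omega> f y =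
     Inf {u. measure lebesgue {x \<in> \<Omega>. f x \<le> u} / measure lebesgue \<Omega> \<ge> y}"

definition multi_at_top :: "(nat ^ 'd) filter" where
  "multi_at_top = filtercomap (\<lambda>n. Min (range (\<lambda>j. n $ j))) at_top"

text \<open>
  In a family of grids, \<open>x n i\<close> is the point with multi-index \<open>i\<close> of the grid with index \<open>n\<close>;
  it is meaningful only for \<open>i \<in> {1..n}\<close>, the order on vectors being componentwise.
\<close>

definition asymptotically_uniform_grid ::
    "real ^ 'd \<Rightarrow> real ^ 'd \<Rightarrow> (nat ^ 'd \<Rightarrow> nat ^ 'd \<Rightarrow> real ^ 'd) \<Rightarrow> bool" where
  "asymptotically_uniform_grid a b x \<longleftrightarrow>
     ((\<lambda>n. Max ((\<lambda>i. infnorm (x n i -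
              (\<chi> j. a $ j + real (i $ j) * ((b $ j - a $ j) / real (n $ j))))) ` {1..n}))
        \<longlongrightarrow> 0) multi_at_top"

definition sample_indices ::
    "(real ^ 'd) set \<Rightarrow> (nat ^ 'd \<Rightarrow> nat ^ 'd \<Rightarrow> real ^ 'd) \<Rightarrow> nat ^ 'd \<Rightarrow> (nat ^ 'd) set" where
  "sample_indices \<Omega> x n = {i \<in> {1..n}. x n i \<in> \<Omega>}"

text \<open>
  By truncated subtraction this is \<open>0\<close>, not \<open>-1\<close>, if there are no samples; the spline is
  defined only when the value is at least \<open>1\<close>.
\<close>

definition sample_omega ::
    "(real ^ 'd) set \<Rightarrow> (nat ^ 'd \<Rightarrow> nat ^ 'd \<Rightarrow> real ^ 'd) \<Rightarrow> nat ^ 'd \<Rightarrow> nat" where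
  "sample_omega \<Omega> x n = card (sample_indices \<Omega> x n) - 1"

definition sorted_samples ::
    "(real ^ 'd) set \<Rightarrow> (real ^ 'd \<Rightarrow> real) \<Rightarrow> (nat ^ 'd \<Rightarrow> nat ^ 'd \<Rightarrow> real ^ 'd) \<Rightarrow>
     nat ^ 'd \<Rightarrow> real list" where
  "sorted_samples \<Omega> f x n =
     sorted_list_of_multiset (image_mset (\<lambda>i. f (x n i)) (mset_set (sample_indices \<Omega> x n)))"

definition interpolating_linear_spline :: "nat \<Rightarrow> (nat \<Rightarrow> real) \<Rightarrow> (real \<Rightarrow> real) \<Rightarrow> bool" where
  "interpolating_linear_spline w s F \<longleftrightarrow>
     (\<forall>i\<le>w. F (real i / real w) = s i) \<and>
     (\<forall>i<w. \<exists>m c. \<forall>t\<in>{real i / real w .. real (i + 1) / real w}. F t = m * t + c)"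

end

theory Submission
  imports Defs "HOL-Probability.Distribution_Functions"
begin

text \<open>
  Cut the rectangle into \<open>\<Prod>j. n j\<close> congruent half-open cells and let \<open>\<phi> n t\<close> be the grid point whose
  index is that of the cell containing \<open>t\<close>. The number of grid points in a set \<open>T\<close>, times the volume
  of a cell, is exactly the measure of the preimage of \<open>T\<close> under \<open>\<phi> n\<close>. Since \<open>\<phi> n t\<close> tends to \<open>t\<close>,
  dominated convergence shows that it tends to the measure of \<open>T\<close> whenever the frontier of \<open>T\<close> is
  negligible. This applies to \<open>\<Omega>\<close> and to the sublevel sets \<open>{x \<in> \<Omega>. f x \<le> u}\<close> for all but countably
  many \<open>u\<close>, so the empirical distribution functions of the samples converge to that of \<open>f\<close> at those
  \<open>u\<close>. Convergence of the quantile functions at continuity points follows, because the spline at \<open>y\<close>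
  lies between two consecutive order statistics. As \<open>f\<^sup>\<dagger>\<close> is monotone, its discontinuities are
  countable.
\<close>

section \<open>Limits along multi-indices and dominated convergence for sets\<close>

lemma eventually_multi_at_top:
  "eventually P (multi_at_top :: (nat ^ 'd) filter) \<longleftrightarrow> (\<exists>k. \<forall>n. (\<forall>j. k \<le> n $ j) \<longrightarrow> P n)"
  unfolding multi_at_top_def eventually_filtercomap_at_top_linorder by (simp add: Min_ge_iff)

lemma filterlim_component_multi_at_top:
  "filterlim (\<lambda>n::nat ^ 'd. n $ j) at_top multi_at_top"
  unfolding filterlim_at_top eventually_multi_at_top by blast

lemma eventually_one_le_multi_at_top: "\<forall>\<^sub>F n in multi_at_top. 1 \<le> (n :: nat ^ 'd)"
  unfolding eventually_multi_at_top less_eq_vec_def by auto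

lemma tendsto_divide_component:
  "((\<lambda>n. r / real (n $ j)) \<longlongrightarrow> 0) (multi_at_top :: (nat ^ 'd) filter)"
  by (intro tendsto_divide_0[OF tendsto_const] filterlim_at_top_imp_at_infinity
      filterlim_compose[OF filterlim_real_sequentially filterlim_component_multi_at_top])

text \<open>A failure of convergence is witnessed, for each \<open>k\<close>, by an index with all
  components at least \<open>k\<close>; these indices form a sequence tending to
  \<open>multi_at_top\<close>. This opens the way to dominated convergence, which is stated for
  sequences.\<close>

lemma tendsto_multi_at_topI_sequentially:
  fixes g :: "nat ^ 'd \<Rightarrow> 'a::topological_space"
  assumes "\<And>N. filterlim N multi_at_top sequentially \<Longrightarrow> (\<lambda>k. g (N k)) \<longlonglongrightarrow> L"
  shows "(g \<longlongrightarrow> L) multi_at_top"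
proof (rule topological_tendstoI, rule ccontr)
  fix S assume S: "open S" "L \<in> S" "\<not> (\<forall>\<^sub>F n in multi_at_top. g n \<in> S)"
  then have "\<forall>k. \<exists>n. (\<forall>j. k \<le> n $ j) \<and> g n \<notin> S"
    unfolding eventually_multi_at_top by blast
  then obtain N where N: "\<And>k j. k \<le> N k $ j" "\<And>k. g (N k) \<notin> S"
    unfolding choice_iff by blast
  have "filterlim N multi_at_top sequentially"
    unfolding filterlim_iff eventually_multi_at_top eventually_sequentially
    by (meson N(1) le_trans)
  from topological_tendstoD[OF assms[OF this] S(1,2)] N(2) show False
    by simp
qed

text \<open>Dominated convergence for indicator functions, with \<open>indicator B\<close> as the
  integrable bound.\<close>

lemma tendsto_measure_AE_eventually_eq:
  assumes B: "B \<in> fmeasurable M" and S: "\<And>k. S k \<in> sets M" "\<And>k. S k \<subseteq> B"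
    and T: "T \<in> sets M" and ev: "AE t in M. \<forall>\<^sub>F k in sequentially. t \<in> S k \<longleftrightarrow> t \<in> T"
  shows "(\<lambda>k. measure M (S k)) \<longlonglongrightarrow> measure M T"
proof -
  have "(\<lambda>k. LINT t|M. (indicator (S k) t :: real)) \<longlonglongrightarrow> (LINT t|M. indicator T t)"
  proof (rule integral_dominated_convergence[where w="indicator B"])
    show "integrable M (indicator B :: _ \<Rightarrow> real)"
      using B by (auto simp: fmeasurable_def intro: integrable_real_indicator)
    show "AE t in M. (\<lambda>k. indicator (S k) t :: real) \<longlonglongrightarrow> indicator T t"
      using ev by eventually_elim (auto intro!: tendsto_eventually elim: eventually_mono simp: indicator_def)
    show "AE t in M. norm (indicator (S k) t :: real) \<le> indicator B t" for k
      using S(2) by (auto simp: indicator_def)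
  qed (use S T in auto)
  then show ?thesis
    using S T sets.sets_into_space[of _ M] by (simp add: Int_absorb2)
qed

section \<open>Decomposition of the rectangle into half-open cells\<close>

text \<open>Open below and closed above, so that adjacent cells tile the rectangle without overlap
  and every point has exactly one cell.\<close>

definition half_open_box :: "real ^ 'd \<Rightarrow> real ^ 'd \<Rightarrow> (real ^ 'd) set" where
  "half_open_box a b = {t. \<forall>j. a $ j < t $ j \<and> t $ j \<le> b $ j}"

lemma box_subset_half_open_box: "box a b \<subseteq> half_open_box a b"
  by (auto simp: half_open_box_def mem_box_cart less_imp_le)

lemma half_open_box_lmeasurable: "half_open_box a b \<in> lmeasurable"
proof (rule bounded_set_imp_lmeasurable)
  show "bounded (half_open_box a b)"
    by (rule bounded_subset[OF bounded_cbox[of a b]])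
       (auto simp: half_open_box_def mem_box_cart less_imp_le)
  have "half_open_box a b = (\<Inter>j. {t. a $ j < t $ j} \<inter> {t. t $ j \<le> b $ j})"
    by (auto simp: half_open_box_def)
  also have "\<dots> \<in> sets borel"
    by (intro sets.finite_INT sets.Int borel_open borel_closed
        open_halfspace_component_gt_cart closed_halfspace_component_le_cart) auto
  finally show "half_open_box a b \<in> sets lebesgue"
    by (metis sets_completionI_sets sets_lborel)
qed

text \<open>The half-open box lies between \<open>box a b\<close> and \<open>cbox a b\<close>, which
  have the same volume.\<close>

lemma measure_half_open_box:
  assumes "a \<le> b"
  shows "measure lebesgue (half_open_box a b) = (\<Prod>j\<in>UNIV. b $ j - a $ j)"
proof (rule antisym)
  have ne: "cbox a b \<noteq> {}"
    using assms by (auto simp: less_eq_vec_def interval_ne_empty_cart)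
  have "measure lebesgue (half_open_box a b) \<le> measure lebesgue (cbox a b)"
    by (rule measure_mono_fmeasurable[OF _ fmeasurableD[OF half_open_box_lmeasurable] lmeasurable_cbox])
       (auto simp: half_open_box_def mem_box_cart less_imp_le)
  then show "measure lebesgue (half_open_box a b) \<le> (\<Prod>j\<in>UNIV. b $ j - a $ j)"
    using content_cbox_cart[OF ne] by simp
  have "measure lebesgue (box a b) \<le> measure lebesgue (half_open_box a b)"
    by (rule measure_mono_fmeasurable[OF box_subset_half_open_box _ half_open_box_lmeasurable]) simp
  then show "(\<Prod>j\<in>UNIV. b $ j - a $ j) \<le> measure lebesgue (half_open_box a b)"
    using content_cbox_cart[OF ne] by (simp add: measure_lborel_box_eq measure_lborel_cbox_eq)
qed

lemma finite_vec_interval: "finite {m..n :: nat ^ 'd}"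
proof (rule finite_imageD)
  show "finite (vec_nth ` {m..n})"
  proof (rule finite_subset)
    show "vec_nth ` {m..n} \<subseteq> Pi\<^sub>E UNIV (\<lambda>j. {..n $ j})"
      by (auto simp: less_eq_vec_def)
    show "finite (Pi\<^sub>E UNIV (\<lambda>j. {..n $ j}))"
      by (intro finite_PiE) auto
  qed
  show "inj_on vec_nth {m..n}"
    by (auto simp: inj_on_def vec_nth_inject)
qed

text \<open>Rounding up makes the node with this index the upper corner of the cell containing
  \<open>t\<close>.\<close>

definition cell_index :: "real ^ 'd \<Rightarrow> real ^ 'd \<Rightarrow> nat ^ 'd \<Rightarrow> real ^ 'd \<Rightarrow> nat ^ 'd" where
  "cell_index a b n t = (\<chi> j. nat \<lceil>(t $ j - a $ j) * real (n $ j) / (b $ j - a $ j)\<rceil>)"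

text \<open>The exact grid with which \<open>asymptotically_uniform_grid\<close> compares.
  Components of \<open>i\<close> may be 0, so that \<open>uniform_node a b n (i - 1)\<close> is the
  lower corner of cell \<open>i\<close>.\<close>

definition uniform_node :: "real ^ 'd \<Rightarrow> real ^ 'd \<Rightarrow> nat ^ 'd \<Rightarrow> nat ^ 'd \<Rightarrow> real ^ 'd" where
  "uniform_node a b n i = (\<chi> j. a $ j + real (i $ j) * ((b $ j - a $ j) / real (n $ j)))"

lemma one_le_vec_nat_iff: "1 \<le> (n :: nat ^ 'd) \<longleftrightarrow> (\<forall>j. n $ j > 0)"
  by (auto simp: less_eq_vec_def Suc_le_eq)

lemma uniform_node_step:
  assumes "1 \<le> i"
  shows "uniform_node a b n i $ j - uniform_node a b n (i - 1) $ j = (b $ j - a $ j) / real (n $ j)"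
  using assms by (simp add: uniform_node_def one_le_vec_nat_iff Suc_leI left_diff_distrib diff_divide_distrib)

lemma cell_index_in:
  assumes ab: "\<And>j. a $ j < b $ j" and n: "1 \<le> n" and t: "t \<in> half_open_box a b"
  shows "cell_index a b n t \<in> {1..n}"
proof -
  have "0 < (t $ j - a $ j) * real (n $ j) / (b $ j - a $ j)"
       "(t $ j - a $ j) * real (n $ j) / (b $ j - a $ j) \<le> real (n $ j)" for j
    using ab[of j] n t by (auto simp: half_open_box_def one_le_vec_nat_iff field_simps)
  then show ?thesis
    by (simp add: less_eq_vec_def cell_index_def Suc_le_eq ceiling_le_iff nat_le_iff)
qed

text \<open>After rescaling each coordinate to \<open>?q j\<close>, both sides say that
  \<open>?q j\<close> lies above \<open>real (i $ j) - 1\<close> and at most at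
  \<open>real (i $ j)\<close>; the bounds of the rectangle then follow from
  \<open>i \<in> {1..n}\<close>.\<close>

lemma cell_index_eq_iff:
  assumes ab: "\<And>j. a $ j < b $ j" and n: "1 \<le> n" and i: "i \<in> {1..n}"
  shows "t \<in> half_open_box a b \<and> cell_index a b n t = i \<longleftrightarrow>
    t \<in> half_open_box (uniform_node a b n (i - 1)) (uniform_node a b n i)"
proof -
  let ?q = "\<lambda>j. (t $ j - a $ j) * real (n $ j) / (b $ j - a $ j)"
  have "(a $ j < t $ j \<and> t $ j \<le> b $ j \<and> nat \<lceil>?q j\<rceil> = i $ j) \<longleftrightarrow>
    (uniform_node a b n (i - 1) $ j < t $ j \<and> t $ j \<le> uniform_node a b n i $ j)" for j
  proof -
    have nj: "n $ j > 0" and ij: "i $ j > 0" "i $ j \<le> n $ j"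
      using n i one_le_vec_nat_iff[of n] one_le_vec_nat_iff[of i] by (auto simp: less_eq_vec_def)
    have 1: "a $ j < t $ j \<longleftrightarrow> 0 < ?q j" "t $ j \<le> b $ j \<longleftrightarrow> ?q j \<le> real (n $ j)"
      using ab[of j] nj by (auto simp: field_simps zero_less_mult_iff)
    have 2: "uniform_node a b n (i - 1) $ j < t $ j \<longleftrightarrow> real (i $ j) - 1 < ?q j"
      "t $ j \<le> uniform_node a b n i $ j \<longleftrightarrow> ?q j \<le> real (i $ j)"
      using ab[of j] nj ij by (auto simp: uniform_node_def field_simps of_nat_diff)
    have "nat \<lceil>?q j\<rceil> = i $ j \<longleftrightarrow> real (i $ j) - 1 < ?q j \<and> ?q j \<le> real (i $ j)"
    proof -
      \<comment> \<open>As \<open>i $ j\<close> is positive, the truncation by \<open>nat\<close>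
        loses nothing.\<close>
      have "nat \<lceil>?q j\<rceil> = i $ j \<longleftrightarrow> \<lceil>?q j\<rceil> = int (i $ j)"
        using ij by linarith
      then show ?thesis by (simp add: ceiling_eq_iff)
    qed
    then show ?thesis unfolding 1 2 using ij by auto
  qed
  then show ?thesis
    unfolding half_open_box_def cell_index_def vec_eq_iff by auto
qed

text \<open>The set is the disjoint union of the cells whose index satisfies \<open>P\<close>, and
  all cells have the same volume. With \<open>P\<close> testing whether a grid point lies in a given
  set, counting grid points becomes measuring a set.\<close>

lemma
  assumes ab: "\<And>j. a $ j < b $ j" and n: "1 \<le> n"
  shows cell_index_preimage_lmeasurable:
      "{t \<in> half_open_box a b. P (cell_index a b n t)} \<in> lmeasurable" (is "?S \<in> _")
    and measure_cell_index_preimage: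
      "measure lebesgue {t \<in> half_open_box a b. P (cell_index a b n t)} =
        real (card {i \<in> {1..n}. P i}) * (\<Prod>j\<in>UNIV. (b $ j - a $ j) / real (n $ j))"
proof -
  let ?I = "{i \<in> {1..n}. P i}"
  let ?C = "\<lambda>i. half_open_box (uniform_node a b n (i - 1)) (uniform_node a b n i)"
  have fin: "finite ?I"
    by (rule finite_subset[OF _ finite_vec_interval[of 1 n]]) auto
  have C: "?C i = {t \<in> half_open_box a b. cell_index a b n t = i}" if "i \<in> {1..n}" for i
    using cell_index_eq_iff[OF ab n that] by auto
  have S: "?S = (\<Union>i\<in>?I. ?C i)"
    using C cell_index_in[OF ab n] by auto
  show "?S \<in> lmeasurable"
    unfolding S by (intro fmeasurable.finite_UN fin half_open_box_lmeasurable)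
  have "measure lebesgue ?S = (\<Sum>i\<in>?I. measure lebesgue (?C i))"
    unfolding S
  proof (rule measure_UNION'[OF fin half_open_box_lmeasurable])
    show "pairwise (\<lambda>i j. disjnt (?C i) (?C j)) ?I"
      using C by (auto simp: pairwise_def disjnt_def)
  qed
  also have "\<dots> = (\<Sum>i\<in>?I. \<Prod>j\<in>UNIV. (b $ j - a $ j) / real (n $ j))"
  proof (rule sum.cong[OF refl])
    fix i assume i: "i \<in> ?I"
    have "uniform_node a b n i $ j - uniform_node a b n (i - 1) $ j = (b $ j - a $ j) / real (n $ j)" for j
      using i by (intro uniform_node_step) simp
    moreover have "uniform_node a b n (i - 1) \<le> uniform_node a b n i"
      using ab by (auto simp: uniform_node_def less_eq_vec_def less_imp_le intro!: divide_right_mono mult_right_mono)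
    ultimately show "measure lebesgue (?C i) = (\<Prod>j\<in>UNIV. (b $ j - a $ j) / real (n $ j))"
      by (simp add: measure_half_open_box)
  qed
  finally show "measure lebesgue ?S = real (card ?I) * (\<Prod>j\<in>UNIV. (b $ j - a $ j) / real (n $ j))"
    by simp
qed

section \<open>Grid counts and Lebesgue measure\<close>

text \<open>In each coordinate the node of the cell is within one cell width of \<open>t\<close>,
  and the grid point is within the maximal deviation \<open>?M n\<close> of the node; both bounds
  tend to 0.\<close>

lemma grid_point_tendsto:
  assumes grid: "asymptotically_uniform_grid a b x"
    and ab: "\<And>j. a $ j < b $ j" and t: "t \<in> half_open_box a b"
  shows "((\<lambda>n. x n (cell_index a b n t)) \<longlongrightarrow> t) multi_at_top"
proof (rule vec_tendstoI)
  fix j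
  let ?M = "\<lambda>n. Max ((\<lambda>i. infnorm (x n i - uniform_node a b n i)) ` {1..n})"
  have M: "(?M \<longlongrightarrow> 0) multi_at_top"
    using grid by (simp add: asymptotically_uniform_grid_def uniform_node_def)
  from tendsto_add[OF M tendsto_divide_component[of "b $ j - a $ j" j]]
  have lim: "((\<lambda>n. ?M n + (b $ j - a $ j) / real (n $ j)) \<longlongrightarrow> 0) multi_at_top" by simp
  have "\<forall>\<^sub>F n in multi_at_top. norm (x n (cell_index a b n t) $ j - t $ j) \<le>
     ?M n + (b $ j - a $ j) / real (n $ j)"
    using eventually_one_le_multi_at_top
  proof eventually_elim
    case (elim n)
    define i where "i = cell_index a b n t"
    have i: "i \<in> {1..n}" unfolding i_def by (rule cell_index_in[OF ab elim t])
    have "\<bar>(x n i - uniform_node a b n i) $ j\<bar> \<le> infnorm (x n i - uniform_node a b n i)"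
      by (rule component_le_infnorm_cart)
    also have "\<dots> \<le> ?M n"
      by (rule Max_ge) (use i finite_vec_interval in auto)
    finally have 1: "\<bar>x n i $ j - uniform_node a b n i $ j\<bar> \<le> ?M n" by simp
    have "t \<in> half_open_box (uniform_node a b n (i - 1)) (uniform_node a b n i)"
      using cell_index_eq_iff[OF ab elim i, of t] t i_def by blast
    then have "uniform_node a b n (i - 1) $ j < t $ j" "t $ j \<le> uniform_node a b n i $ j"
      by (auto simp: half_open_box_def)
    moreover have "uniform_node a b n i $ j - uniform_node a b n (i - 1) $ j = (b $ j - a $ j) / real (n $ j)"
      using i by (intro uniform_node_step) simp
    ultimately show ?case using 1 unfolding i_def[symmetric] by simp
  qed
  then have "((\<lambda>n. x n (cell_index a b n t) $ j - t $ j) \<longlongrightarrow> 0) multi_at_top"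
    by (rule Lim_null_comparison[OF _ lim])
  then show "((\<lambda>n. x n (cell_index a b n t) $ j) \<longlongrightarrow> t $ j) multi_at_top"
    by (simp add: LIM_zero_iff)
qed

text \<open>The expression is a Riemann sum of the indicator function of \<open>T\<close> with
  perturbed tags, and a bounded set with negligible frontier is Jordan measurable.\<close>

lemma grid_count_tendsto_measure:
  fixes T :: "(real ^ 'd) set"
  assumes grid: "asymptotically_uniform_grid a b x" and ab: "\<And>j. a $ j < b $ j"
    and T: "T \<subseteq> cbox a b" "negligible (frontier T)"
  shows "((\<lambda>n. real (card {i \<in> {1..n}. x n i \<in> T}) * (\<Prod>j\<in>UNIV. (b $ j - a $ j) / real (n $ j)))
    \<longlongrightarrow> measure lebesgue T) multi_at_top"
proof -
  define S where "S n = {t \<in> half_open_box a b. x n (cell_index a b n t) \<in> T}" for n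
  \<comment> \<open>\<open>S n\<close> is known to be measurable only for \<open>1 \<le> n\<close>;
    the empty set at the other indices makes every term of a sequence measurable and leaves the
    limit unchanged.\<close>
  have "((\<lambda>n. measure lebesgue (if 1 \<le> n then S n else {})) \<longlongrightarrow> measure lebesgue T) multi_at_top"
  proof (rule tendsto_multi_at_topI_sequentially)
    fix N :: "nat \<Rightarrow> nat ^ 'd" assume N: "filterlim N multi_at_top sequentially"
    show "(\<lambda>k. measure lebesgue (if 1 \<le> N k then S (N k) else {})) \<longlonglongrightarrow> measure lebesgue T"
    proof (rule tendsto_measure_AE_eventually_eq[OF half_open_box_lmeasurable[of a b]])
      show "(if 1 \<le> N k then S (N k) else {}) \<in> sets lebesgue" for k
        using cell_index_preimage_lmeasurable[OF ab, of "N k" "\<lambda>i. x (N k) i \<in> T"]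
        unfolding S_def by auto
      show "(if 1 \<le> N k then S (N k) else {}) \<subseteq> half_open_box a b" for k
        unfolding S_def by auto
      show "T \<in> sets lebesgue"
        by (rule fmeasurableD[OF measurable_Jordan[OF bounded_subset[OF bounded_cbox T(1)] T(2)]])
      \<comment> \<open>The boundary of the rectangle is discarded too: any other point outside the
        half-open box is outside \<open>cbox a b\<close>, hence in neither \<open>T\<close> nor any
        \<open>S n\<close>.\<close>
      have "negligible (frontier T \<union> (cbox a b - box a b))"
        using T(2) negligible_frontier_interval[of a b] by (rule negligible_Un)
      then have "AE t in lebesgue. t \<notin> frontier T \<union> (cbox a b - box a b)"
        unfolding negligible_iff_null_sets by (rule AE_not_in)
      then show "AE t in lebesgue. \<forall>\<^sub>F k in sequentially.
          t \<in> (if 1 \<le> N k then S (N k) else {}) \<longleftrightarrow> t \<in> T"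
      proof eventually_elim
        case (elim t)
        show ?case
        proof (cases "t \<in> half_open_box a b")
          case False
          then have "t \<notin> box a b"
            using box_subset_half_open_box by blast
          with False elim T(1) show ?thesis unfolding S_def by auto
        next
          case True
          have "(\<lambda>k. x (N k) (cell_index a b (N k) t)) \<longlonglongrightarrow> t"
            by (rule filterlim_compose[OF grid_point_tendsto[OF grid ab True] N])
          \<comment> \<open>Off the frontier, \<open>t\<close> is interior to \<open>T\<close> or to
            its complement, so membership in \<open>T\<close> is constant near
            \<open>t\<close>.\<close>
          moreover have "\<forall>\<^sub>F s in nhds t. s \<in> T \<longleftrightarrow> t \<in> T"
          proof (cases "t \<in> T")
            case True
            then have "t \<in> interior T"
              using elim closure_subset[of T] by (auto simp: frontier_def)
            from eventually_nhds_in_open[OF open_interior this] True show ?thesis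
              by (auto elim: eventually_mono dest: subsetD[OF interior_subset])
          next
            case False
            then have "t \<in> - closure T"
              using elim interior_subset[of T] by (auto simp: frontier_def)
            from eventually_nhds_in_open[OF open_Compl[OF closed_closure] this] False
            show ?thesis
              by (auto elim: eventually_mono dest: subsetD[OF closure_subset])
          qed
          ultimately have "\<forall>\<^sub>F k in sequentially. x (N k) (cell_index a b (N k) t) \<in> T \<longleftrightarrow> t \<in> T"
            unfolding filterlim_iff by blast
          moreover have "\<forall>\<^sub>F k in sequentially. 1 \<le> N k"
            using N eventually_one_le_multi_at_top unfolding filterlim_iff by blast
          ultimately show ?thesis
            by eventually_elim (simp add: S_def True)
        qed
      qed
    qed
  qed
  moreover have "\<forall>\<^sub>F n in multi_at_top. measure lebesgue (if 1 \<le> n then S n else {}) =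
      real (card {i \<in> {1..n}. x n i \<in> T}) * (\<Prod>j\<in>UNIV. (b $ j - a $ j) / real (n $ j))"
    using eventually_one_le_multi_at_top
  proof eventually_elim
    case (elim n)
    from measure_cell_index_preimage[OF ab elim, of "\<lambda>i. x n i \<in> T"] elim show ?case
      by (simp only: S_def if_True)
  qed
  ultimately show ?thesis
    by (rule Lim_transform_eventually)
qed

section \<open>Sublevel sets of almost everywhere continuous functions\<close>

text \<open>At an interior point of \<open>\<Omega>\<close> where \<open>f\<close> is continuous and
  differs from \<open>u\<close>, the strict inequality persists nearby, so the point is interior to
  the sublevel set or to its complement.\<close>

lemma frontier_sublevel_subset:
  fixes f :: "'a::t2_space \<Rightarrow> real"
  shows "frontier {x \<in> \<Omega>. f x \<le> u} \<subseteq>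
    frontier \<Omega> \<union> {x \<in> \<Omega>. \<not> continuous (at x within \<Omega>) f} \<union> {x \<in> \<Omega>. f x = u}"
proof
  fix t assume t: "t \<in> frontier {x \<in> \<Omega>. f x \<le> u}"
  let ?T = "{x \<in> \<Omega>. f x \<le> u}"
  show "t \<in> frontier \<Omega> \<union> {x \<in> \<Omega>. \<not> continuous (at x within \<Omega>) f} \<union> {x \<in> \<Omega>. f x = u}"
  proof (rule ccontr)
    assume not: "\<not> ?thesis"
    have "t \<in> closure \<Omega>"
      using t closure_mono[of ?T \<Omega>] by (auto simp: frontier_def)
    with not have int: "t \<in> interior \<Omega>" by (auto simp: frontier_def)
    then have "t \<in> \<Omega>" using interior_subset by auto
    with not have "isCont f t" and "f t \<noteq> u"
      using at_within_interior[OF int] \<open>t \<in> \<Omega>\<close> by auto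
    have lim: "(f \<longlongrightarrow> f t) (nhds t)"
      using \<open>isCont f t\<close> by (simp add: isCont_def tendsto_at_iff_tendsto_nhds)
    have in\<Omega>: "\<forall>\<^sub>F s in nhds t. s \<in> \<Omega>"
      by (rule eventually_mono[OF eventually_nhds_in_open[OF open_interior int]])
         (use interior_subset in blast)
    consider "f t < u" | "f t > u" using \<open>f t \<noteq> u\<close> by linarith
    then show False
    proof cases
      case 1
      from order_tendstoD(2)[OF lim 1] in\<Omega> have "\<forall>\<^sub>F s in nhds t. s \<in> ?T"
        by eventually_elim auto
      then have "t \<in> interior ?T" by (simp add: interior_def eventually_nhds) blast
      with t show False by (simp add: frontier_def)
    next
      case 2
      from order_tendstoD(1)[OF lim 2] have "\<forall>\<^sub>F s in nhds t. s \<in> - ?T"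
        by eventually_elim auto
      then have "t \<in> interior (- ?T)" by (simp add: interior_def eventually_nhds) blast
      with t show False by (simp add: frontier_def interior_closure)
    qed
  qed
qed

lemma continuous_ae_on_imp_negligible:
  "continuous_ae_on \<Omega> f \<Longrightarrow> negligible {x \<in> \<Omega>. \<not> continuous (at x within \<Omega>) f}"
  unfolding continuous_ae_on_def negligible_iff_null_sets[symmetric]
  by (erule AE_E3) (auto simp: negligible_iff_null_sets[symmetric] intro: negligible_subset)

text \<open>Off the null set \<open>D\<close> of discontinuities the restriction of \<open>f\<close>
  is continuous, hence measurable; within \<open>D\<close> every subset is measurable by
  completeness of Lebesgue measure.\<close>

lemma continuous_ae_on_imp_measurable:
  fixes f :: "real ^ 'd \<Rightarrow> real"
  assumes \<Omega>: "\<Omega> \<in> sets lebesgue" and f: "continuous_ae_on \<Omega> f"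
  shows "f \<in> borel_measurable (lebesgue_on \<Omega>)"
proof (rule borel_measurableI_le)
  fix u
  define D where "D = {x \<in> \<Omega>. \<not> continuous (at x within \<Omega>) f}"
  have D: "negligible D" unfolding D_def by (rule continuous_ae_on_imp_negligible[OF f])
  have C: "\<Omega> - D \<in> sets lebesgue"
    using \<Omega> D negligible_imp_sets by blast
  have "continuous_on (\<Omega> - D) f"
    unfolding continuous_on_eq_continuous_within D_def
    by (auto intro: continuous_within_subset)
  then have "f \<in> borel_measurable (lebesgue_on (\<Omega> - D))"
    using C by (rule continuous_imp_measurable_on_sets_lebesgue)
  then have "{x \<in> space (lebesgue_on (\<Omega> - D)). f x \<le> u} \<in> sets (lebesgue_on (\<Omega> - D))"
    by measurable
  then have "{x \<in> \<Omega> - D. f x \<le> u} \<in> sets lebesgue"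
    using C by (simp add: sets_restrict_space_iff)
  moreover have "{x \<in> D. f x \<le> u} \<in> sets lebesgue"
    by (rule negligible_imp_sets[OF negligible_subset[OF D]]) auto
  ultimately have "{x \<in> \<Omega> - D. f x \<le> u} \<union> {x \<in> D. f x \<le> u} \<in> sets lebesgue"
    by (rule sets.Un)
  also have "{x \<in> \<Omega> - D. f x \<le> u} \<union> {x \<in> D. f x \<le> u} = {x \<in> \<Omega>. f x \<le> u}"
    by (auto simp: D_def)
  finally show "{x \<in> space (lebesgue_on \<Omega>). f x \<le> u} \<in> sets (lebesgue_on \<Omega>)"
    using \<Omega> by (simp add: sets_restrict_space_iff)
qed

section \<open>Order statistics and the interpolating spline\<close>

text \<open>In a sorted list the entries up to \<open>u\<close> form an initial segment; indices
  start at 0, hence the strict inequality.\<close>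

lemma sorted_nth_le_iff:
  fixes xs :: "'a::linorder list"
  assumes "sorted xs" "i < length xs"
  shows "xs ! i \<le> u \<longleftrightarrow> i < length (filter (\<lambda>v. v \<le> u) xs)"
  using assms
proof (induction xs arbitrary: i)
  case (Cons v xs)
  show ?case
  proof (cases "v \<le> u")
    case True
    with Cons show ?thesis by (cases i) auto
  next
    case False
    then have "\<forall>z \<in> set (v # xs). u < z"
      using Cons.prems(1) by auto
    then have "filter (\<lambda>v. v \<le> u) (v # xs) = []" "u < (v # xs) ! i"
      using Cons.prems(2) nth_mem[of i "v # xs"] by (auto simp: filter_empty_conv not_le simp del: nth_mem)
    then show ?thesis by simp
  qed
qed simp

text \<open>An affine piece with non-decreasing end values has slope \<open>m \<ge> 0\<close>, so it
  stays between those values.\<close>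

lemma interpolating_linear_spline_between:
  assumes spl: "interpolating_linear_spline w s F" and i: "i < w"
    and y: "y \<in> {real i / real w .. real (i + 1) / real w}" and mono: "s i \<le> s (i + 1)"
  shows "s i \<le> F y" "F y \<le> s (i + 1)"
proof -
  let ?p = "real i / real w" and ?q = "real (i + 1) / real w"
  obtain m c where mc: "\<And>t. t \<in> {?p .. ?q} \<Longrightarrow> F t = m * t + c"
    using spl i unfolding interpolating_linear_spline_def by blast
  have pq: "?p < ?q" using i by (simp add: divide_strict_right_mono)
  have s: "F ?p = s i" "F ?q = s (i + 1)"
    using spl i unfolding interpolating_linear_spline_def by (auto dest!: spec[of _ "i + 1"])
  have "F ?p = m * ?p + c" "F ?q = m * ?q + c" "F y = m * y + c"
    using mc pq y by auto
  with s have e: "s i = m * ?p + c" "s (i + 1) = m * ?q + c" "F y = m * y + c" by auto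
  have "m * (?q - ?p) \<ge> 0" using e mono by (simp add: right_diff_distrib del: of_nat_add)
  then have m: "m \<ge> 0" using pq by (simp add: zero_le_mult_iff del: of_nat_add)
  show "s i \<le> F y" "F y \<le> s (i + 1)"
    unfolding e using y m mult_left_mono[of ?p y m] mult_left_mono[of y ?q m] by auto
qed

text \<open>The spline at \<open>y\<close> lies between two consecutive order statistics, and
  counting samples up to \<open>u\<close> locates these relative to \<open>u\<close>. The margin 2
  absorbs the rounding of \<open>y * real w\<close> and the difference between \<open>w\<close> and
  \<open>length xs\<close>.\<close>

lemma
  assumes sorted: "sorted xs" and len: "length xs \<ge> 2"
    and spl: "interpolating_linear_spline (length xs - 1) (\<lambda>i. xs ! i) F" and y: "0 < y" "y < 1"
  shows spline_le_if_many_samples_le: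
      "y * real (length xs) + 2 \<le> real (length (filter (\<lambda>v. v \<le> u) xs)) \<Longrightarrow> F y \<le> u"
    and spline_greater_if_few_samples_le:
      "real (length (filter (\<lambda>v. v \<le> u) xs)) \<le> y * real (length xs) - 2 \<Longrightarrow> u < F y"
proof -
  define w where "w = length xs - 1"
  \<comment> \<open>The interpolation interval containing \<open>y\<close>; \<open>y < 1\<close>
    gives \<open>i < w\<close>, so node \<open>i + 1\<close> exists.\<close>
  define i where "i = nat \<lfloor>y * real w\<rfloor>"
  have w: "w \<ge> 1" "real w = real (length xs) - 1" "length xs = Suc w" using len by (auto simp: w_def)
  have i_le: "real i \<le> y * real w" and i_gt: "y * real w < real i + 1"
    unfolding i_def using y by (auto simp: of_nat_floor)
  have "y * real w < real w" using y w by simp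
  with i_le have i: "i < w" by linarith
  have yi: "y \<in> {real i / real w .. real (i + 1) / real w}"
    using i_le i_gt w(1) by (auto simp: field_simps)
  have mono: "xs ! i \<le> xs ! (i + 1)"
    using sorted i w by (intro sorted_nth_mono) auto
  note b = interpolating_linear_spline_between[OF spl[folded w_def] i yi mono]
  let ?K = "length (filter (\<lambda>v. v \<le> u) xs)"
  have yl: "y * real (length xs) = y * real w + y" using w by (simp add: algebra_simps)
  {
    assume "y * real (length xs) + 2 \<le> real ?K"
    then have "i + 1 < ?K" using i_le yl y by linarith
    then have "xs ! (i + 1) \<le> u"
      using sorted_nth_le_iff[OF sorted, of "i + 1" u] i w by simp
    with b show "F y \<le> u" by linarith
  next
    assume "real ?K \<le> y * real (length xs) - 2"
    then have "\<not> i < ?K" using i_gt yl y by linarith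
    then have "\<not> xs ! i \<le> u"
      using sorted_nth_le_iff[OF sorted, of i u] i w by simp
    with b show "u < F y" by linarith
  }
qed

lemma finite_sample_indices: "finite (sample_indices \<Omega> x n)"
  unfolding sample_indices_def by (rule finite_subset[OF _ finite_vec_interval[of 1 n]]) auto

lemma length_sorted_samples: "length (sorted_samples \<Omega> f x n) = card (sample_indices \<Omega> x n)"
  unfolding sorted_samples_def size_mset[symmetric] mset_sorted_list_of_multiset by simp

text \<open>Sorting preserves the multiset of samples; this turns positions in the sorted list into
  grid counts.\<close>

lemma length_filter_sorted_samples:
  "length (filter (\<lambda>v. v \<le> u) (sorted_samples \<Omega> f x n)) =
    card {i \<in> {1..n}. x n i \<in> {z \<in> \<Omega>. f z \<le> u}}"
proof -
  have "length (filter (\<lambda>v. v \<le> u) (sorted_samples \<Omega> f x n)) =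
      size (filter_mset (\<lambda>v. v \<le> u) (image_mset (\<lambda>i. f (x n i)) (mset_set (sample_indices \<Omega> x n))))"
    unfolding sorted_samples_def size_mset[symmetric] mset_filter mset_sorted_list_of_multiset ..
  also have "\<dots> = card {i \<in> sample_indices \<Omega> x n. f (x n i) \<le> u}"
    by (simp add: filter_mset_image_mset filter_mset_mset_set finite_sample_indices)
  also have "{i \<in> sample_indices \<Omega> x n. f (x n i) \<le> u} = {i \<in> {1..n}. x n i \<in> {z \<in> \<Omega>. f z \<le> u}}"
    by (auto simp: sample_indices_def)
  finally show ?thesis .
qed

section \<open>Generalized inverse of a distribution function\<close>

context
  fixes F :: "real \<Rightarrow> real"
  assumes mono: "mono F" and at_bot: "(F \<longlongrightarrow> 0) at_bot" and at_top: "(F \<longlongrightarrow> 1) at_top"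
begin

text \<open>Together with nonemptiness this makes \<open>Inf\<close> a genuine infimum. Far to the
  left, \<open>F\<close> is below \<open>y\<close>.\<close>

lemma quantile_set_bdd_below:
  assumes "0 < y" shows "bdd_below {u. F u \<ge> y}"
proof -
  from order_tendstoD(2)[OF at_bot assms] obtain l where "\<And>u. u \<le> l \<Longrightarrow> F u < y"
    by (auto simp: eventually_at_bot_linorder)
  then show ?thesis
    by (intro bdd_belowI[of _ l]) (metis linorder_le_cases mem_Collect_eq not_le)
qed

lemma quantile_set_nonempty:
  assumes "y < 1" shows "{u. F u \<ge> y} \<noteq> {}"
proof -
  from order_tendstoD(1)[OF at_top assms] obtain l where "\<And>u. u \<ge> l \<Longrightarrow> y < F u"
    by (auto simp: eventually_at_top_linorder)
  then show ?thesis by (auto intro!: exI[of _ l] less_imp_le)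
qed

text \<open>Some element of the set lies below \<open>u\<close>, and monotonicity carries its bound
  up to \<open>u\<close>.\<close>

lemma quantile_less_imp_le:
  assumes "y < 1" "Inf {u. F u \<ge> y} < u" shows "y \<le> F u"
proof -
  from cInf_lessD[OF quantile_set_nonempty[OF assms(1)] assms(2)]
  obtain v where "F v \<ge> y" "v < u" by auto
  with monoD[OF mono, of v u] show ?thesis by simp
qed

lemma less_quantile_imp_less:
  assumes "0 < y" "u < Inf {u. F u \<ge> y}" shows "F u < y"
  using cInf_lower[OF _ quantile_set_bdd_below[OF assms(1)], of u] assms(2)
  by (auto simp: not_le[symmetric])

text \<open>Raising \<open>y\<close> shrinks the set and so raises its infimum.\<close>

lemma quantile_mono_on: "mono_on {0<..<1} (\<lambda>y. Inf {u. F u \<ge> y})"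
  by (intro mono_onI cInf_superset_mono quantile_set_nonempty quantile_set_bdd_below) auto

end

section \<open>Distribution function of \<open>f\<close> and its exceptional levels\<close>

text \<open>The sublevel measure is the \<open>cdf\<close> of the push-forward \<open>?D\<close> of
  the measure on \<open>\<Omega>\<close>. Non-null level sets are atoms of \<open>?D\<close>, and a
  finite measure has only countably many.\<close>

lemma
  fixes f :: "'a \<Rightarrow> real"
  assumes \<Omega>: "\<Omega> \<in> fmeasurable M" and f: "f \<in> borel_measurable (restrict_space M \<Omega>)"
  shows sublevel_measure_mono: "mono (\<lambda>u. measure M {x \<in> \<Omega>. f x \<le> u})"
    and sublevel_measure_at_bot: "((\<lambda>u. measure M {x \<in> \<Omega>. f x \<le> u}) \<longlongrightarrow> 0) at_bot"
    and sublevel_measure_at_top: "((\<lambda>u. measure M {x \<in> \<Omega>. f x \<le> u}) \<longlongrightarrow> measure M \<Omega>) at_top"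
    and countable_level_not_null: "countable {u. {x \<in> \<Omega>. f x = u} \<notin> null_sets M}"
proof -
  let ?R = "restrict_space M \<Omega>"
  let ?D = "distr ?R borel f"
  have \<Omega>s: "\<Omega> \<in> sets M" using \<Omega> by auto
  then have sp: "\<Omega> \<inter> space M = \<Omega>" by (rule sets.Int_space_eq2)
  interpret R: finite_measure ?R
    by (rule finite_measureI)
       (use \<Omega> \<Omega>s sp in \<open>auto simp: space_restrict_space emeasure_restrict_space fmeasurable_def\<close>)
  interpret D: finite_borel_measure ?D
    by (intro finite_borel_measure.intro R.finite_measure_distr f finite_borel_measure_axioms.intro) simp
  have meas: "measure ?D A = measure M {x \<in> \<Omega>. f x \<in> A}" if "A \<in> sets borel" for A
  proof -
    have "f -` A \<inter> space ?R = {x \<in> \<Omega>. f x \<in> A}"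
      using sp by (auto simp: space_restrict_space)
    then show ?thesis
      using that f sp \<Omega>s by (simp add: measure_distr measure_restrict_space)
  qed
  have cdf: "cdf ?D = (\<lambda>u. measure M {x \<in> \<Omega>. f x \<le> u})"
    by (simp add: cdf_def meas)
  have total: "measure ?D (space ?D) = measure M \<Omega>"
    by (simp add: meas)
  show "mono (\<lambda>u. measure M {x \<in> \<Omega>. f x \<le> u})"
    unfolding cdf[symmetric] by (intro monoI D.cdf_nondecreasing)
  show "((\<lambda>u. measure M {x \<in> \<Omega>. f x \<le> u}) \<longlongrightarrow> 0) at_bot"
    unfolding cdf[symmetric] by (rule D.cdf_lim_at_bot)
  show "((\<lambda>u. measure M {x \<in> \<Omega>. f x \<le> u}) \<longlongrightarrow> measure M \<Omega>) at_top"
    unfolding cdf[symmetric] total[symmetric] by (rule D.cdf_lim_at_top)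
  show "countable {u. {x \<in> \<Omega>. f x = u} \<notin> null_sets M}"
  proof (rule countable_subset[OF _ D.countable_atoms], clarify)
    fix u assume u: "{x \<in> \<Omega>. f x = u} \<notin> null_sets M"
    have "f -` {u} \<inter> space ?R \<in> sets ?R"
      using f by (rule measurable_sets) simp
    moreover have "f -` {u} \<inter> space ?R = {x \<in> \<Omega>. f x = u}"
      using sp by (auto simp: space_restrict_space)
    ultimately have s: "{x \<in> \<Omega>. f x = u} \<in> sets M"
      using \<Omega>s sp by (simp add: sets_restrict_space_iff)
    then have "{x \<in> \<Omega>. f x = u} \<in> fmeasurable M"
      by (rule fmeasurableI2[OF \<Omega>, rotated]) auto
    then have "measure M {x \<in> \<Omega>. f x = u} \<noteq> 0"
      using u s by (auto simp: emeasure_eq_measure2 null_sets_def)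
    then show "measure ?D {u} > 0"
      using meas[of "{u}"] by (simp add: zero_less_measure_iff)
  qed
qed

section \<open>Convergence of the splines\<close>

text \<open>\<open>W n\<close> is the product of \<open>W n * c n\<close>, with positive limit, and
  \<open>inverse (c n)\<close>, which diverges.\<close>

lemma filterlim_at_top_of_tendsto_mult_pos:
  fixes c W :: "'a \<Rightarrow> real"
  assumes "((\<lambda>n. W n * c n) \<longlongrightarrow> m) F" "(c \<longlongrightarrow> 0) F" "\<forall>\<^sub>F n in F. c n > 0" "m > 0"
  shows "filterlim W at_top F"
proof -
  have "filterlim (\<lambda>n. W n * c n * inverse (c n)) at_top F"
    using assms by (intro filterlim_tendsto_pos_mult_at_top[OF assms(1)] filterlim_inverse_at_top)
  then show ?thesis
    by (rule filterlim_cong[THEN iffD1, OF refl refl, rotated])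
       (use assms(3) in eventually_elim, simp)
qed

theorem theorem3p1:
  fixes \<Omega> :: "(real ^ 'd) set"
    and f :: "real ^ 'd \<Rightarrow> real"
    and a b :: "real ^ 'd"
    and x :: "nat ^ 'd \<Rightarrow> nat ^ 'd \<Rightarrow> real ^ 'd"
    and fn :: "nat ^ 'd \<Rightarrow> real \<Rightarrow> real"
  assumes "regular_set \<Omega>"
    and "emeasure lebesgue \<Omega> > 0"
    and "continuous_ae_on \<Omega> f"
    and "a \<le> b"
    and "\<Omega> \<subseteq> cbox a b"
    and "asymptotically_uniform_grid a b x"
    and "\<And>n. 1 \<le> n \<Longrightarrow> sample_omega \<Omega> x n \<ge> 1 \<Longrightarrow>
           interpolating_linear_spline (sample_omega \<Omega> x n)
             (\<lambda>i. sorted_samples \<Omega> f x n ! i) (fn n)"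
  shows "(\<forall>y\<in>{0<..<1}. isCont (monotone_rearrangement \<Omega> f) y \<longrightarrow>
            ((\<lambda>n. fn n y) \<longlongrightarrow> monotone_rearrangement \<Omega> f y) multi_at_top) \<and>
         (AE y in lebesgue. y \<in> {0<..<1} \<longrightarrow>
            ((\<lambda>n. fn n y) \<longlongrightarrow> monotone_rearrangement \<Omega> f y) multi_at_top)"
proof -
  note spl = assms(7) and grid = assms(6)
  have front: "negligible (frontier \<Omega>)" and bnd: "bounded \<Omega>"
    using assms(1) by (auto simp: regular_set_def negligible_iff_emeasure0)
  have \<Omega>: "\<Omega> \<in> lmeasurable"
    by (rule measurable_Jordan[OF bnd front])
  have m\<Omega>: "measure lebesgue \<Omega> > 0"
    using assms(2) \<Omega> by (simp add: emeasure_eq_measure2)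
  \<comment> \<open>Positive measure of \<open>\<Omega>\<close> forces the rectangle to be
    nondegenerate in every coordinate.\<close>
  have "\<not> negligible (cbox a b)"
    using m\<Omega> negligible_subset[OF _ assms(5)] negligible_imp_measure0 by fastforce
  then have "box a b \<noteq> {}" using negligible_interval(1) by blast
  then have ab: "a $ j < b $ j" for j
    by (simp add: interval_ne_empty_cart)
  have f: "f \<in> borel_measurable (lebesgue_on \<Omega>)"
    by (rule continuous_ae_on_imp_measurable[OF fmeasurableD[OF \<Omega>] assms(3)])

  \<comment> \<open>\<open>c n\<close> is the cell volume, \<open>W n\<close> the number of samples,
    \<open>K u n\<close> the number of samples up to \<open>u\<close>, and \<open>F\<close> the
    distribution function of \<open>f\<close>, with quantile function \<open>Q\<close>.\<close>
  define c where "c n = (\<Prod>j\<in>UNIV. (b $ j - a $ j) / real (n $ j))" for n :: "nat ^ 'd"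
  define W where "W n = card {i \<in> {1..n}. x n i \<in> \<Omega>}" for n
  define K where "K u n = card {i \<in> {1..n}. x n i \<in> {z \<in> \<Omega>. f z \<le> u}}" for u n
  define F where "F u = measure lebesgue {z \<in> \<Omega>. f z \<le> u} / measure lebesgue \<Omega>" for u
  define Q where "Q = monotone_rearrangement \<Omega> f"
  have Q: "Q y = Inf {u. F u \<ge> y}" for y
    by (simp add: Q_def monotone_rearrangement_def F_def)

  have c_pos: "\<forall>\<^sub>F n in multi_at_top. c n > 0"
    using eventually_one_le_multi_at_top
    by eventually_elim (use ab in \<open>auto simp: c_def one_le_vec_nat_iff intro!: prod_pos\<close>)
  have "((\<lambda>n. (b $ j - a $ j) / real (n $ j)) \<longlongrightarrow> 0) (multi_at_top :: (nat ^ 'd) filter)" for j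
    by (rule tendsto_divide_component)
  then have "(c \<longlongrightarrow> (\<Prod>j\<in>(UNIV :: 'd set). 0)) multi_at_top"
    unfolding c_def by (rule tendsto_prod)
  \<comment> \<open>The product has at least one factor, so its limit is 0 and not an empty
    product.\<close>
  then have c0: "(c \<longlongrightarrow> 0) multi_at_top" by (simp add: zero_power)
  have W: "((\<lambda>n. real (W n) * c n) \<longlongrightarrow> measure lebesgue \<Omega>) multi_at_top"
    unfolding W_def c_def by (rule grid_count_tendsto_measure[OF grid ab assms(5) front])
  have W_top: "filterlim (\<lambda>n. real (W n)) at_top multi_at_top"
    by (rule filterlim_at_top_of_tendsto_mult_pos[OF W c0 c_pos m\<Omega>])

  \<comment> \<open>The levels at which the sublevel set has negligible frontier; their complement
    is countable, so they are dense.\<close>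
  define G where "G = {u. {z \<in> \<Omega>. f z = u} \<in> null_sets lebesgue}"
  have G: "\<exists>u\<in>G. p < u \<and> u < q" if "p < q" for p q :: real
    using real_interval_avoid_countable_set[OF that countable_level_not_null[OF \<Omega> f]]
    by (auto simp: G_def)
  \<comment> \<open>Both counts are normalized by the same cell volume, which cancels in the
    quotient.\<close>
  have KF: "((\<lambda>n. real (K u n) / real (W n)) \<longlongrightarrow> F u) multi_at_top" if u: "u \<in> G" for u
  proof -
    have "negligible {z \<in> \<Omega>. f z = u}" using u by (simp add: G_def negligible_iff_null_sets)
    then have "negligible (frontier {z \<in> \<Omega>. f z \<le> u})"
      by (intro negligible_subset[OF _ frontier_sublevel_subset] negligible_Un front
          continuous_ae_on_imp_negligible[OF assms(3)])
    then have "((\<lambda>n. real (K u n) * c n) \<longlongrightarrow> measure lebesgue {z \<in> \<Omega>. f z \<le> u}) multi_at_top"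
      unfolding K_def c_def using assms(5) by (intro grid_count_tendsto_measure[OF grid ab]) auto
    from tendsto_divide[OF this W] m\<Omega>
    have "((\<lambda>n. (real (K u n) * c n) / (real (W n) * c n)) \<longlongrightarrow> F u) multi_at_top"
      by (simp add: F_def)
    then show ?thesis
      by (rule Lim_transform_eventually) (use c_pos in eventually_elim, simp)
  qed

  have monoF: "mono F"
    using sublevel_measure_mono[OF \<Omega> f] m\<Omega> by (auto simp: mono_def F_def intro!: divide_right_mono)
  have F0: "(F \<longlongrightarrow> 0) at_bot"
    using tendsto_divide[OF sublevel_measure_at_bot[OF \<Omega> f] tendsto_const[of "measure lebesgue \<Omega>"]] m\<Omega>
    by (simp add: F_def[abs_def])
  have F1: "(F \<longlongrightarrow> 1) at_top"
    using tendsto_divide[OF sublevel_measure_at_top[OF \<Omega> f] tendsto_const[of "measure lebesgue \<Omega>"]] m\<Omega>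
    by (simp add: F_def[abs_def])

  have len: "length (sorted_samples \<Omega> f x n) = W n" for n
    by (simp add: length_sorted_samples W_def sample_indices_def)
  have K: "length (filter (\<lambda>v. v \<le> u) (sorted_samples \<Omega> f x n)) = K u n" for n u
    unfolding K_def length_filter_sorted_samples ..
  have srt: "sorted (sorted_samples \<Omega> f x n)" for n
    by (simp add: sorted_samples_def)
  \<comment> \<open>Two samples guarantee \<open>sample_omega \<Omega> x n \<ge> 1\<close>, where
    the spline is defined.\<close>
  have spl': "interpolating_linear_spline (length (sorted_samples \<Omega> f x n) - 1)
      (\<lambda>i. sorted_samples \<Omega> f x n ! i) (fn n)" if "1 \<le> n" "W n \<ge> 2" for n
    using spl[of n] that len[of n] by (simp add: length_sorted_samples sample_omega_def)
  have sample_le: "fn n y \<le> u"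
    if "1 \<le> n" "W n \<ge> 2" "0 < y" "y < 1" "y * real (W n) + 2 \<le> real (K u n)" for n y u
    using that len K by (intro spline_le_if_many_samples_le[OF srt _ spl']) auto
  have sample_gt: "u < fn n y"
    if "1 \<le> n" "W n \<ge> 2" "0 < y" "y < 1" "real (K u n) \<le> y * real (W n) - 2" for n y u
    using that len K by (intro spline_greater_if_few_samples_le[OF srt _ spl']) auto

  \<comment> \<open>The fixed margin 2 is eventually smaller than any positive fraction of the
    sample count.\<close>
  have W_large: "\<forall>\<^sub>F n in multi_at_top. 1 \<le> n \<and> W n \<ge> 2 \<and> 2 \<le> \<delta> * real (W n)" if "\<delta> > 0" for \<delta>
  proof -
    have "\<forall>\<^sub>F n in multi_at_top. max 2 (2 / \<delta>) \<le> real (W n)"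
      using W_top unfolding filterlim_at_top by blast
    with eventually_one_le_multi_at_top show ?thesis
      by eventually_elim (use that in \<open>auto simp: field_simps\<close>)
  qed

  have conv: "((\<lambda>n. fn n y) \<longlongrightarrow> Q y) multi_at_top" if y: "0 < y" "y < 1" and cont: "isCont Q y" for y
  proof (rule order_tendstoI)
    \<comment> \<open>Continuity at \<open>y\<close> allows moving to a nearby \<open>z\<close> on
      either side while \<open>Q z\<close> stays on the same side of \<open>l\<close>; the gap
      between \<open>z\<close> and \<open>y\<close> then pays for the margin 2.\<close>
    have Ql: "(Q \<longlongrightarrow> Q y) (at_left y)" and Qr: "(Q \<longlongrightarrow> Q y) (at_right y)"
      using cont by (auto simp: isCont_def filterlim_at_split)
    {
      fix l assume "l < Q y"
      then have "\<forall>\<^sub>F z in at_left y. l < Q z"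
        by (rule order_tendstoD(1)[OF Ql])
      moreover have "\<forall>\<^sub>F z in at_left y. z \<in> {0<..<y}"
        using y by (intro eventually_at_left_real)
      ultimately have "\<forall>\<^sub>F z in at_left y. l < Q z \<and> 0 < z \<and> z < y"
        by eventually_elim auto
      then obtain z where z: "l < Q z" "0 < z" "z < y"
        using eventually_happens'[OF trivial_limit_at_left_real] by blast
      then obtain u where u: "u \<in> G" "l < u" "u < Q z" using G by blast
      have "F u < z"
        using less_quantile_imp_less[OF monoF F0 F1 z(2)] u(3) by (simp add: Q)
      from order_tendstoD(2)[OF KF[OF u(1)] this]
        W_large[of "y - z"] z
      have "\<forall>\<^sub>F n in multi_at_top. real (K u n) / real (W n) < z \<and>
          1 \<le> n \<and> W n \<ge> 2 \<and> 2 \<le> (y - z) * real (W n)"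
        by (auto intro: eventually_conj)
      then show "\<forall>\<^sub>F n in multi_at_top. l < fn n y"
      proof eventually_elim
        case (elim n)
        then have "real (W n) > 0" by linarith
        with elim have "real (K u n) \<le> z * real (W n)" by (simp add: pos_divide_less_eq)
        with elim have "real (K u n) \<le> y * real (W n) - 2" by (simp add: left_diff_distrib)
        with elim y have "u < fn n y" by (intro sample_gt) auto
        with u show ?case by simp
      qed
    next
      fix l assume "Q y < l"
      then have "\<forall>\<^sub>F z in at_right y. Q z < l"
        by (rule order_tendstoD(2)[OF Qr])
      moreover have "\<forall>\<^sub>F z in at_right y. z \<in> {y<..<1}"
        using y by (intro eventually_at_right_real)
      ultimately have "\<forall>\<^sub>F z in at_right y. Q z < l \<and> y < z \<and> z < 1"
        by eventually_elim auto
      then obtain z where z: "Q z < l" "y < z" "z < 1"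
        using eventually_happens'[OF trivial_limit_at_right_real] by blast
      \<comment> \<open>Only the weak bound \<open>z \<le> F u\<close> is available, while the limit
        of the empirical ratios gives lower bounds strictly below \<open>F u\<close>; the midpoint
        leaves room for this and for the margin.\<close>
      define z' where "z' = (y + z) / 2"
      have z': "y < z'" "z' < z" using z by (auto simp: z'_def)
      obtain u where u: "u \<in> G" "Q z < u" "u < l" using G z by blast
      have "z \<le> F u"
        using quantile_less_imp_le[OF monoF F0 F1 z(3)] u(2) by (simp add: Q)
      then have "z' < F u" using z' by simp
      from order_tendstoD(1)[OF KF[OF u(1)] this]
        W_large[of "z' - y"] z'
      have "\<forall>\<^sub>F n in multi_at_top. z' < real (K u n) / real (W n) \<and>
          1 \<le> n \<and> W n \<ge> 2 \<and> 2 \<le> (z' - y) * real (W n)"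
        by (auto intro: eventually_conj)
      then show "\<forall>\<^sub>F n in multi_at_top. fn n y < l"
      proof eventually_elim
        case (elim n)
        then have "real (W n) > 0" by linarith
        with elim have "z' * real (W n) \<le> real (K u n)" by (simp add: pos_less_divide_eq)
        with elim have "y * real (W n) + 2 \<le> real (K u n)" by (simp add: left_diff_distrib)
        with elim y have "fn n y \<le> u" by (intro sample_le) auto
        with u show ?case by simp
      qed
    }
  qed

  \<comment> \<open>A monotone function on an open interval has countably many discontinuities,
    which form a null set.\<close>
  have "mono_on {0<..<1} Q"
    using quantile_mono_on[OF monoF F0 F1] by (simp add: Q[abs_def])
  then have "countable {y \<in> {0<..<1}. \<not> isCont Q y}"
    by (intro mono_on_ctble_discont_open) auto
  then have "{y \<in> {0<..<1}. \<not> isCont Q y} \<in> null_sets lebesgue"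
    by (intro null_sets_completionI countable_imp_null_set_lborel)
  then have "AE y in lebesgue. y \<notin> {y \<in> {0<..<1}. \<not> isCont Q y}"
    by (rule AE_not_in)
  then have "AE y in lebesgue. y \<in> {0<..<1} \<longrightarrow> ((\<lambda>n. fn n y) \<longlongrightarrow> Q y) multi_at_top"
    by eventually_elim (use conv in auto)
  with conv show ?thesis unfolding Q_def by auto
qed

end
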